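(* Let $\mathbb{X}$ be a Cartesian differential category with differential combinator $\mathsf{D}$. Then $\mathbb{X}$ admits a linearizing combinator $\mathsf{L}_\mathsf{D}$ defined on every map $f: A \to B$ by $$\mathsf{L}_\mathsf{D}[f] := \langle 0, 1 \rangle\, \mathsf{D}[f] .$$ Furthermore: (i) for every map $f$, $\mathsf{L}_\mathsf{D}[f]$ is $\mathsf{D}$-linear; (ii) a map $f$ is $\mathsf{D}$-linear if and only if $f$ is $\mathsf{L}_\mathsf{D}$-linear.
   Context: Composition is in diagrammatic order: $fg$ means first $f$, then $g$; identities are written $1$. A left additive category is a category whose hom-sets are commutative monoids $(+,0)$ with $f(g+h)=fg+fh$ and $f0=0$. A map $f$ is reduced if $0f=0$, semi-additive if $(g+h)f=gf+hf$ for all $g,h$, and additive if it is both. A Cartesian left additive category is a left additive category with (chosen) finite products whose projections $\pi_0,\pi_1$ are additive; $\langle -,-\rangle$ is pairing and $f\times g=\langle \pi_0 f,\pi_1 g\rangle$. Put $\oplus_A:=\pi_0+\pi_1:A\times A\to A$; $\ell_{A,B,C,D}:=\langle 1,0\rangle\times\langle 0,1\rangle: A\times D\to (A\times B)\times(C\times D)$; $c_{A,B,C,D}:=\langle \pi_0\times\pi_0,\pi_1\times\pi_1\rangle:(A\times B)\times(C\times D)\to(A\times C)\times(B\times D)$ (subscripts omitted). A Cartesian differential category is a Cartesian left additive category $\mathbb{X}$ with a differential combinator $\mathsf{D}$, i.e. a family of operators $\mathsf{D}:\mathbb{X}(A,B)\to\mathbb{X}(A\times A,B)$ such that: [CD.1]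 $\mathsf{D}[f+g]=\mathsf{D}[f]+\mathsf{D}[g]$, $\mathsf{D}[0]=0$; [CD.2] $(1\times\oplus_A)\mathsf{D}[f]=(1\times\pi_0)\mathsf{D}[f]+(1\times\pi_1)\mathsf{D}[f]$, $\langle 1,0\rangle\mathsf{D}[f]=0$; [CD.3] $\mathsf{D}[1]=\pi_1$, $\mathsf{D}[\pi_0]=\pi_1\pi_0$, $\mathsf{D}[\pi_1]=\pi_1\pi_1$; [CD.4] $\mathsf{D}[\langle f,g\rangle]=\langle\mathsf{D}[f],\mathsf{D}[g]\rangle$; [CD.5] $\mathsf{D}[fg]=\langle\pi_0 f,\mathsf{D}[f]\rangle\mathsf{D}[g]$; [CD.6] $\ell\,\mathsf{D}[\mathsf{D}[f]]=\mathsf{D}[f]$; [CD.7] $c\,\mathsf{D}[\mathsf{D}[f]]=\mathsf{D}[\mathsf{D}[f]]$. A map $f$ is $\mathsf{D}$-linear if $\mathsf{D}[f]=\pi_1 f$. A linearizing combinator $\mathsf{L}$ on a Cartesian left additive category $\mathbb{X}$ is a family of operators $\mathsf{L}:\mathbb{X}(A,B)\to\mathbb{X}(A,B)$ such that: [L.1] $\mathsf{L}[f+g]=\mathsf{L}[f]+\mathsf{L}[g]$, $\mathsf{L}[0]=0$; [L.2] $\mathsf{L}[f]$ is additive; [L.3] $\mathsf{L}[1]=1$, $\mathsf{L}[\pi_0]=\pi_0$, $\mathsf{L}[\pi_1]=\pi_1$; [L.4] $\mathsf{L}[\langle f,g\rangle]=\langle\mathsf{L}[f],\mathsf{L}[g]\rangle$;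 [L.5] $\mathsf{L}[fg]=\mathsf{L}[f]\,\mathsf{L}[(1+0f)g]$; [L.6] $\mathsf{L}[\mathsf{L}[f]]=\mathsf{L}[f]$. A map $f$ is $\mathsf{L}$-linear if $\mathsf{L}[f]=f$. *)

theory Defs
  imports Main
begin

text \<open>
  Composition is written in diagrammatic order: \<open>f \<cdot> g\<close> is first \<open>f\<close>, then \<open>g\<close>.
  Every arrow carries its own domain and codomain, so composition, addition, pairing and the
  combinators need no object subscripts; identities, zero maps and projections take the
  objects as arguments. All operations are constrained only on arrows of the appropriate type.
\<close>

record ('o, 'm) cat =
  Obj :: "'o set"
  Arr :: "'m set"
  Dom :: "'m \<Rightarrow> 'o"
  Cod :: "'m \<Rightarrow> 'o"
  Comp :: "'m \<Rightarrow> 'm \<Rightarrow> 'm"  (infixl "\<cdot>\<index>" 70)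
  Ident :: "'o \<Rightarrow> 'm"  ("\<one>\<index>")

definition hom :: "('o, 'm, 'x) cat_scheme \<Rightarrow> 'o \<Rightarrow> 'o \<Rightarrow> 'm set" where
  "hom X A B = {f \<in> Arr X. Dom X f = A \<and> Cod X f = B}"

locale category =
  fixes X :: "('o, 'm, 'x) cat_scheme" (structure)
  assumes dom_obj: "f \<in> Arr X \<Longrightarrow> Dom X f \<in> Obj X"
    and cod_obj: "f \<in> Arr X \<Longrightarrow> Cod X f \<in> Obj X"
    and comp_hom: "\<lbrakk>f \<in> hom X A B; g \<in> hom X B C\<rbrakk> \<Longrightarrow> f \<cdot> g \<in> hom X A C"
    and id_hom: "A \<in> Obj X \<Longrightarrow> \<one> A \<in> hom X A A"
    and comp_assoc: "\<lbrakk>f \<in> hom X A B; g \<in> hom X B C; h \<in> hom X C E\<rbrakk>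
      \<Longrightarrow> (f \<cdot> g) \<cdot> h = f \<cdot> (g \<cdot> h)"
    and id_comp: "f \<in> hom X A B \<Longrightarrow> \<one> A \<cdot> f = f"
    and comp_id: "f \<in> hom X A B \<Longrightarrow> f \<cdot> \<one> B = f"

record ('o, 'm) left_additive_cat = "('o, 'm) cat" +
  Plus :: "'m \<Rightarrow> 'm \<Rightarrow> 'm"  (infixl "\<oplus>\<index>" 65)
  Zero :: "'o \<Rightarrow> 'o \<Rightarrow> 'm"  ("\<zero>\<index>")

locale left_additive_category = category X
  for X :: "('o, 'm, 'x) left_additive_cat_scheme" (structure) +
  assumes plus_hom: "\<lbrakk>f \<in> hom X A B; g \<in> hom X A B\<rbrakk> \<Longrightarrow> f \<oplus> g \<in> hom X A B"
    and zero_hom: "\<lbrakk>A \<in> Obj X; B \<in> Obj X\<rbrakk> \<Longrightarrow> \<zero> A B \<in> hom X A B"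
    and plus_assoc: "\<lbrakk>f \<in> hom X A B; g \<in> hom X A B; h \<in> hom X A B\<rbrakk>
      \<Longrightarrow> (f \<oplus> g) \<oplus> h = f \<oplus> (g \<oplus> h)"
    and plus_comm: "\<lbrakk>f \<in> hom X A B; g \<in> hom X A B\<rbrakk> \<Longrightarrow> f \<oplus> g = g \<oplus> f"
    and zero_plus: "f \<in> hom X A B \<Longrightarrow> \<zero> A B \<oplus> f = f"
    and comp_plus: "\<lbrakk>f \<in> hom X A B; g \<in> hom X B C; h \<in> hom X B C\<rbrakk>
      \<Longrightarrow> f \<cdot> (g \<oplus> h) = f \<cdot> g \<oplus> f \<cdot> h"
    and comp_zero: "\<lbrakk>f \<in> hom X A B; C \<in> Obj X\<rbrakk> \<Longrightarrow> f \<cdot> \<zero> B C = \<zero> A C"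

definition reduced :: "('o, 'm, 'x) left_additive_cat_scheme \<Rightarrow> 'm \<Rightarrow> bool" where
  "reduced X f \<longleftrightarrow>
    (\<forall>C \<in> Obj X. \<zero>\<^bsub>X\<^esub> C (Dom X f) \<cdot>\<^bsub>X\<^esub> f = \<zero>\<^bsub>X\<^esub> C (Cod X f))"

definition semi_additive :: "('o, 'm, 'x) left_additive_cat_scheme \<Rightarrow> 'm \<Rightarrow> bool" where
  "semi_additive X f \<longleftrightarrow>
    (\<forall>C \<in> Obj X. \<forall>g \<in> hom X C (Dom X f). \<forall>h \<in> hom X C (Dom X f).
      (g \<oplus>\<^bsub>X\<^esub> h) \<cdot>\<^bsub>X\<^esub> f = g \<cdot>\<^bsub>X\<^esub> f \<oplus>\<^bsub>X\<^esub> h \<cdot>\<^bsub>X\<^esub> f)"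

definition additive :: "('o, 'm, 'x) left_additive_cat_scheme \<Rightarrow> 'm \<Rightarrow> bool" where
  "additive X f \<longleftrightarrow> reduced X f \<and> semi_additive X f"

text \<open>Chosen finite products are given by a chosen terminal object and chosen binary products.\<close>

record ('o, 'm) cartesian_left_additive_cat = "('o, 'm) left_additive_cat" +
  Terminal :: 'o
  Prod :: "'o \<Rightarrow> 'o \<Rightarrow> 'o"  (infixr "\<^bold>\<times>\<index>" 80)
  Proj0 :: "'o \<Rightarrow> 'o \<Rightarrow> 'm"  ("\<pi>\<^sub>0\<index>")
  Proj1 :: "'o \<Rightarrow> 'o \<Rightarrow> 'm"  ("\<pi>\<^sub>1\<index>")
  Pairing :: "'m \<Rightarrow> 'm \<Rightarrow> 'm"  ("\<langle>_,/ _\<rangle>\<index>")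

locale cartesian_left_additive_category = left_additive_category X
  for X :: "('o, 'm, 'x) cartesian_left_additive_cat_scheme" (structure) +
  assumes terminal_obj: "Terminal X \<in> Obj X"
    and terminal_unique: "A \<in> Obj X \<Longrightarrow> \<exists>!f. f \<in> hom X A (Terminal X)"
    and prod_obj: "\<lbrakk>A \<in> Obj X; B \<in> Obj X\<rbrakk> \<Longrightarrow> A \<^bold>\<times> B \<in> Obj X"
    and proj0_hom: "\<lbrakk>A \<in> Obj X; B \<in> Obj X\<rbrakk> \<Longrightarrow> \<pi>\<^sub>0 A B \<in> hom X (A \<^bold>\<times> B) A"
    and proj1_hom: "\<lbrakk>A \<in> Obj X; B \<in> Obj X\<rbrakk> \<Longrightarrow> \<pi>\<^sub>1 A B \<in> hom X (A \<^bold>\<times> B) B"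
    and pair_hom: "\<lbrakk>f \<in> hom X C A; g \<in> hom X C B\<rbrakk> \<Longrightarrow> \<langle>f, g\<rangle> \<in> hom X C (A \<^bold>\<times> B)"
    and pair_proj0: "\<lbrakk>f \<in> hom X C A; g \<in> hom X C B\<rbrakk> \<Longrightarrow> \<langle>f, g\<rangle> \<cdot> \<pi>\<^sub>0 A B = f"
    and pair_proj1: "\<lbrakk>f \<in> hom X C A; g \<in> hom X C B\<rbrakk> \<Longrightarrow> \<langle>f, g\<rangle> \<cdot> \<pi>\<^sub>1 A B = g"
    and pair_unique: "\<lbrakk>A \<in> Obj X; B \<in> Obj X; h \<in> hom X C (A \<^bold>\<times> B)\<rbrakk>
      \<Longrightarrow> \<langle>h \<cdot> \<pi>\<^sub>0 A B, h \<cdot> \<pi>\<^sub>1 A B\<rangle> = h"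
    and proj0_additive: "\<lbrakk>A \<in> Obj X; B \<in> Obj X\<rbrakk> \<Longrightarrow> additive X (\<pi>\<^sub>0 A B)"
    and proj1_additive: "\<lbrakk>A \<in> Obj X; B \<in> Obj X\<rbrakk> \<Longrightarrow> additive X (\<pi>\<^sub>1 A B)"

definition prod_map ::
    "('o, 'm, 'x) cartesian_left_additive_cat_scheme \<Rightarrow> 'm \<Rightarrow> 'm \<Rightarrow> 'm"
    (infixr "\<otimes>\<index>" 80) where
  "f \<otimes>\<^bsub>X\<^esub> g = \<langle>\<pi>\<^sub>0\<^bsub>X\<^esub> (Dom X f) (Dom X g) \<cdot>\<^bsub>X\<^esub> f,
               \<pi>\<^sub>1\<^bsub>X\<^esub> (Dom X f) (Dom X g) \<cdot>\<^bsub>X\<^esub> g\<rangle>\<^bsub>X\<^esub>"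

definition sum_map :: "('o, 'm, 'x) cartesian_left_additive_cat_scheme \<Rightarrow> 'o \<Rightarrow> 'm" where
  "sum_map X A = \<pi>\<^sub>0\<^bsub>X\<^esub> A A \<oplus>\<^bsub>X\<^esub> \<pi>\<^sub>1\<^bsub>X\<^esub> A A"

text \<open>The lifting map \<open>\<ell> : A \<times> E \<rightarrow> (A \<times> B) \<times> (C \<times> E)\<close>.\<close>

definition lift_map ::
    "('o, 'm, 'x) cartesian_left_additive_cat_scheme \<Rightarrow> 'o \<Rightarrow> 'o \<Rightarrow> 'o \<Rightarrow> 'o \<Rightarrow> 'm" where
  "lift_map X A B C E =
    \<langle>\<one>\<^bsub>X\<^esub> A, \<zero>\<^bsub>X\<^esub> A B\<rangle>\<^bsub>X\<^esub> \<otimes>\<^bsub>X\<^esub> \<langle>\<zero>\<^bsub>X\<^esub> E C, \<one>\<^bsub>X\<^esub> E\<rangle>\<^bsub>X\<^esub>"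

text \<open>The interchange map \<open>c : (A \<times> B) \<times> (C \<times> E) \<rightarrow> (A \<times> C) \<times> (B \<times> E)\<close>.\<close>

definition interchange_map ::
    "('o, 'm, 'x) cartesian_left_additive_cat_scheme \<Rightarrow> 'o \<Rightarrow> 'o \<Rightarrow> 'o \<Rightarrow> 'o \<Rightarrow> 'm" where
  "interchange_map X A B C E =
    \<langle>\<pi>\<^sub>0\<^bsub>X\<^esub> A B \<otimes>\<^bsub>X\<^esub> \<pi>\<^sub>0\<^bsub>X\<^esub> C E, \<pi>\<^sub>1\<^bsub>X\<^esub> A B \<otimes>\<^bsub>X\<^esub> \<pi>\<^sub>1\<^bsub>X\<^esub> C E\<rangle>\<^bsub>X\<^esub>"

locale cartesian_differential_category = cartesian_left_additive_category X
  for X :: "('o, 'm, 'x) cartesian_left_additive_cat_scheme" (structure) +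
  fixes D :: "'m \<Rightarrow> 'm"
  assumes D_hom: "f \<in> hom X A B \<Longrightarrow> D f \<in> hom X (A \<^bold>\<times> A) B"
    and CD1_plus: "\<lbrakk>f \<in> hom X A B; g \<in> hom X A B\<rbrakk> \<Longrightarrow> D (f \<oplus> g) = D f \<oplus> D g"
    and CD1_zero: "\<lbrakk>A \<in> Obj X; B \<in> Obj X\<rbrakk> \<Longrightarrow> D (\<zero> A B) = \<zero> (A \<^bold>\<times> A) B"
    and CD2_plus: "f \<in> hom X A B
      \<Longrightarrow> (\<one> A \<otimes> sum_map X A) \<cdot> D f
        = (\<one> A \<otimes> \<pi>\<^sub>0 A A) \<cdot> D f \<oplus> (\<one> A \<otimes> \<pi>\<^sub>1 A A) \<cdot> D f"
    and CD2_zero: "f \<in> hom X A B \<Longrightarrow> \<langle>\<one> A, \<zero> A A\<rangle> \<cdot> D f = \<zero> A B"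
    and CD3_id: "A \<in> Obj X \<Longrightarrow> D (\<one> A) = \<pi>\<^sub>1 A A"
    and CD3_proj0: "\<lbrakk>A \<in> Obj X; B \<in> Obj X\<rbrakk>
      \<Longrightarrow> D (\<pi>\<^sub>0 A B) = \<pi>\<^sub>1 (A \<^bold>\<times> B) (A \<^bold>\<times> B) \<cdot> \<pi>\<^sub>0 A B"
    and CD3_proj1: "\<lbrakk>A \<in> Obj X; B \<in> Obj X\<rbrakk>
      \<Longrightarrow> D (\<pi>\<^sub>1 A B) = \<pi>\<^sub>1 (A \<^bold>\<times> B) (A \<^bold>\<times> B) \<cdot> \<pi>\<^sub>1 A B"
    and CD4: "\<lbrakk>f \<in> hom X C A; g \<in> hom X C B\<rbrakk> \<Longrightarrow> D \<langle>f, g\<rangle> = \<langle>D f, D g\<rangle>"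
    and CD5: "\<lbrakk>f \<in> hom X A B; g \<in> hom X B C\<rbrakk> \<Longrightarrow> D (f \<cdot> g) = \<langle>\<pi>\<^sub>0 A A \<cdot> f, D f\<rangle> \<cdot> D g"
    and CD6: "f \<in> hom X A B \<Longrightarrow> lift_map X A A A A \<cdot> D (D f) = D f"
    and CD7: "f \<in> hom X A B \<Longrightarrow> interchange_map X A A A A \<cdot> D (D f) = D (D f)"

definition D_linear ::
    "('o, 'm, 'x) cartesian_left_additive_cat_scheme \<Rightarrow> ('m \<Rightarrow> 'm) \<Rightarrow> 'm \<Rightarrow> bool" where
  "D_linear X D f \<longleftrightarrow> D f = \<pi>\<^sub>1\<^bsub>X\<^esub> (Dom X f) (Dom X f) \<cdot>\<^bsub>X\<^esub> f"

text \<open>In \<open>L5\<close> the zero map is \<open>0 : B \<rightarrow> A\<close>, so that \<open>1 + 0f\<close> is an endomap of \<open>B\<close>.\<close>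

locale linearizing_combinator = cartesian_left_additive_category X
  for X :: "('o, 'm, 'x) cartesian_left_additive_cat_scheme" (structure) +
  fixes L :: "'m \<Rightarrow> 'm"
  assumes L_hom: "f \<in> hom X A B \<Longrightarrow> L f \<in> hom X A B"
    and L1_plus: "\<lbrakk>f \<in> hom X A B; g \<in> hom X A B\<rbrakk> \<Longrightarrow> L (f \<oplus> g) = L f \<oplus> L g"
    and L1_zero: "\<lbrakk>A \<in> Obj X; B \<in> Obj X\<rbrakk> \<Longrightarrow> L (\<zero> A B) = \<zero> A B"
    and L2: "f \<in> hom X A B \<Longrightarrow> additive X (L f)"
    and L3_id: "A \<in> Obj X \<Longrightarrow> L (\<one> A) = \<one> A"
    and L3_proj0: "\<lbrakk>A \<in> Obj X; B \<in> Obj X\<rbrakk> \<Longrightarrow> L (\<pi>\<^sub>0 A B) = \<pi>\<^sub>0 A B"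
    and L3_proj1: "\<lbrakk>A \<in> Obj X; B \<in> Obj X\<rbrakk> \<Longrightarrow> L (\<pi>\<^sub>1 A B) = \<pi>\<^sub>1 A B"
    and L4: "\<lbrakk>f \<in> hom X C A; g \<in> hom X C B\<rbrakk> \<Longrightarrow> L \<langle>f, g\<rangle> = \<langle>L f, L g\<rangle>"
    and L5: "\<lbrakk>f \<in> hom X A B; g \<in> hom X B C\<rbrakk>
      \<Longrightarrow> L (f \<cdot> g) = L f \<cdot> L ((\<one> B \<oplus> \<zero> B A \<cdot> f) \<cdot> g)"
    and L6: "f \<in> hom X A B \<Longrightarrow> L (L f) = L f"

definition L_linear :: "('m \<Rightarrow> 'm) \<Rightarrow> 'm \<Rightarrow> bool" where
  "L_linear L f \<longleftrightarrow> L f = f"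

definition linearization ::
    "('o, 'm, 'x) cartesian_left_additive_cat_scheme \<Rightarrow> ('m \<Rightarrow> 'm) \<Rightarrow> 'm \<Rightarrow> 'm" where
  "linearization X D f =
    \<langle>\<zero>\<^bsub>X\<^esub> (Dom X f) (Dom X f), \<one>\<^bsub>X\<^esub> (Dom X f)\<rangle>\<^bsub>X\<^esub> \<cdot>\<^bsub>X\<^esub> D f"

end

theory Submission
  imports Defs
begin

text \<open>
  Think of \<open>D f\<close> as the directional derivative of \<open>f\<close>: its first argument is the base point and
  its second the direction. Then \<open>linearization X D f\<close> is the derivative at the point \<open>0\<close>.

  The heart of the matter is that this map is \<open>D\<close>-linear. By the chain rule its derivative is the
  second derivative of \<open>f\<close> at \<open>\<langle>\<langle>0, x\<rangle>, \<langle>0, y\<rangle>\<rangle>\<close>. Symmetry (CD.7) turns this into the value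
  at \<open>\<langle>\<langle>0, 0\<rangle>, \<langle>x, y\<rangle>\<rangle>\<close>, which splits by additivity in the last pair (CD.2) as a sum over
  \<open>\<langle>x, 0\<rangle>\<close> and \<open>\<langle>0, y\<rangle>\<close>. Symmetry makes the first summand a derivative in a zero direction, so
  it vanishes, and CD.6 identifies the second with \<open>D f\<close> at \<open>\<langle>0, y\<rangle>\<close>; the base direction
  \<open>x\<close> has disappeared.

  Everything else follows. Evaluating the equation \<open>D f = \<pi>\<^sub>1 f\<close> at base point \<open>0\<close> shows that a
  \<open>D\<close>-linear map is additive, because derivatives are additive in the direction, and that it is
  its own linearization; this gives L.2, L.6 and the characterisation of \<open>D\<close>-linear maps. The law
  L.5 is the chain rule at \<open>0\<close>: the outer map must be differentiated at \<open>0 f\<close> rather than at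
  \<open>0\<close>, and precomposing with the translation \<open>1 + 0 f\<close>, whose derivative is the identity in
  the direction, moves the base point there. The remaining laws are those of \<open>D\<close> precomposed
  with \<open>\<langle>0, 1\<rangle>\<close>.
\<close>

section \<open>Pairing in a Cartesian left additive category\<close>

lemma (in category) homD:
  assumes "f \<in> hom X A B"
  shows "f \<in> Arr X" "Dom X f = A" "Cod X f = B" "A \<in> Obj X" "B \<in> Obj X"
  using assms dom_obj cod_obj by (auto simp: hom_def)

lemma (in left_additive_category) plus_zero:
  assumes "f \<in> hom X A B"
  shows "f \<oplus> \<zero> A B = f"
  using assms homD[OF assms] plus_comm zero_hom zero_plus by metis

context cartesian_left_additive_category
begin

lemma hom_prod_eqI:
  assumes "h \<in> hom X C (A \<^bold>\<times> B)" "k \<in> hom X C (A \<^bold>\<times> B)" "A \<in> Obj X" "B \<in> Obj X"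
    and "h \<cdot> \<pi>\<^sub>0 A B = k \<cdot> \<pi>\<^sub>0 A B" "h \<cdot> \<pi>\<^sub>1 A B = k \<cdot> \<pi>\<^sub>1 A B"
  shows "h = k"
  using assms pair_unique by metis

lemma comp_pair:
  assumes h: "h \<in> hom X E C" and f: "f \<in> hom X C A" and g: "g \<in> hom X C B"
  shows "h \<cdot> \<langle>f, g\<rangle> = \<langle>h \<cdot> f, h \<cdot> g\<rangle>"
proof (rule hom_prod_eqI)
  note ob = homD(4,5)[OF h] homD(5)[OF f] homD(5)[OF g]
  note fg = pair_hom[OF f g] and hf = comp_hom[OF h f] and hg = comp_hom[OF h g]
  show "h \<cdot> \<langle>f, g\<rangle> \<in> hom X E (A \<^bold>\<times> B)" by (rule comp_hom[OF h fg])
  show "\<langle>h \<cdot> f, h \<cdot> g\<rangle> \<in> hom X E (A \<^bold>\<times> B)" by (rule pair_hom[OF hf hg])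
  show "A \<in> Obj X" "B \<in> Obj X" by (fact ob)+
  show "h \<cdot> \<langle>f, g\<rangle> \<cdot> \<pi>\<^sub>0 A B = \<langle>h \<cdot> f, h \<cdot> g\<rangle> \<cdot> \<pi>\<^sub>0 A B"
    by (simp add: comp_assoc[OF h fg proj0_hom] ob pair_proj0[OF f g] pair_proj0[OF hf hg])
  show "h \<cdot> \<langle>f, g\<rangle> \<cdot> \<pi>\<^sub>1 A B = \<langle>h \<cdot> f, h \<cdot> g\<rangle> \<cdot> \<pi>\<^sub>1 A B"
    by (simp add: comp_assoc[OF h fg proj1_hom] ob pair_proj1[OF f g] pair_proj1[OF hf hg])
qed

lemma pair_zero:
  assumes "C \<in> Obj X" "A \<in> Obj X" "B \<in> Obj X"
  shows "\<langle>\<zero> C A, \<zero> C B\<rangle> = \<zero> C (A \<^bold>\<times> B)"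
proof -
  have "\<zero> C (A \<^bold>\<times> B) \<cdot> \<pi>\<^sub>0 A B = \<zero> C A" "\<zero> C (A \<^bold>\<times> B) \<cdot> \<pi>\<^sub>1 A B = \<zero> C B"
    using proj0_additive[of A B] proj1_additive[of A B] homD[OF proj0_hom, of A B]
      homD[OF proj1_hom, of A B] assms
    by (auto simp: additive_def reduced_def)
  then show ?thesis
    using pair_unique[of A B "\<zero> C (A \<^bold>\<times> B)" C] assms by (simp add: zero_hom prod_obj)
qed

lemma pair_plus:
  assumes f: "f \<in> hom X C A" and g: "g \<in> hom X C B"
    and f': "f' \<in> hom X C A" and g': "g' \<in> hom X C B"
  shows "\<langle>f, g\<rangle> \<oplus> \<langle>f', g'\<rangle> = \<langle>f \<oplus> f', g \<oplus> g'\<rangle>"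
proof -
  note ob = homD(4,5)[OF f] homD(5)[OF g]
  note p = pair_hom[OF f g] and p' = pair_hom[OF f' g']
  have "(\<langle>f, g\<rangle> \<oplus> \<langle>f', g'\<rangle>) \<cdot> \<pi>\<^sub>0 A B = f \<oplus> f'"
    using proj0_additive[of A B] homD(2)[OF proj0_hom, of A B] ob p p'
    by (simp add: additive_def semi_additive_def pair_proj0[OF f g] pair_proj0[OF f' g'])
  moreover have "(\<langle>f, g\<rangle> \<oplus> \<langle>f', g'\<rangle>) \<cdot> \<pi>\<^sub>1 A B = g \<oplus> g'"
    using proj1_additive[of A B] homD(2)[OF proj1_hom, of A B] ob p p'
    by (simp add: additive_def semi_additive_def pair_proj1[OF f g] pair_proj1[OF f' g'])
  ultimately show ?thesis
    using pair_unique[OF ob(2,3) plus_hom[OF p p']] by simp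
qed

lemma prod_map_hom:
  assumes f: "f \<in> hom X A A'" and g: "g \<in> hom X B B'"
  shows "f \<otimes> g \<in> hom X (A \<^bold>\<times> B) (A' \<^bold>\<times> B')"
  unfolding prod_map_def homD(2)[OF f] homD(2)[OF g]
  by (intro pair_hom comp_hom[OF proj0_hom f] comp_hom[OF proj1_hom g] homD(4)[OF f] homD(4)[OF g])

lemma pair_prod_map:
  assumes a: "a \<in> hom X C A" and b: "b \<in> hom X C B"
    and f: "f \<in> hom X A A'" and g: "g \<in> hom X B B'"
  shows "\<langle>a, b\<rangle> \<cdot> (f \<otimes> g) = \<langle>a \<cdot> f, b \<cdot> g\<rangle>"
proof -
  note ob = homD(5)[OF a] homD(5)[OF b]
  note p = pair_hom[OF a b] and p0 = proj0_hom[OF ob] and p1 = proj1_hom[OF ob]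
  show ?thesis
    unfolding prod_map_def homD(2)[OF f] homD(2)[OF g]
    by (simp add: comp_pair[OF p comp_hom[OF p0 f] comp_hom[OF p1 g]]
        comp_assoc[OF p p0 f, symmetric] comp_assoc[OF p p1 g, symmetric]
        pair_proj0[OF a b] pair_proj1[OF a b])
qed

lemma pair_sum_map:
  assumes a: "a \<in> hom X C A" and b: "b \<in> hom X C A"
  shows "\<langle>a, b\<rangle> \<cdot> sum_map X A = a \<oplus> b"
  using comp_plus[OF pair_hom[OF a b] proj0_hom proj1_hom] homD(5)[OF a]
    pair_proj0[OF a b] pair_proj1[OF a b]
  by (simp add: sum_map_def)

lemma pair_lift_map:
  assumes a: "a \<in> hom X Z A" and e: "e \<in> hom X Z E" and B: "B \<in> Obj X" and C: "C \<in> Obj X"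
  shows "\<langle>a, e\<rangle> \<cdot> lift_map X A B C E = \<langle>\<langle>a, \<zero> Z B\<rangle>, \<langle>\<zero> Z C, e\<rangle>\<rangle>"
proof -
  note ob = homD(5)[OF a] homD(5)[OF e]
  note iA = id_hom[OF ob(1)] and iE = id_hom[OF ob(2)]
    and zA = zero_hom[OF ob(1) B] and zE = zero_hom[OF ob(2) C]
  show ?thesis
    unfolding lift_map_def
    by (simp add: pair_prod_map[OF a e pair_hom[OF iA zA] pair_hom[OF zE iE]]
        comp_pair[OF a iA zA] comp_pair[OF e zE iE] comp_id[OF a] comp_id[OF e]
        comp_zero[OF a B] comp_zero[OF e C])
qed

lemma pair_interchange_map:
  assumes a: "a \<in> hom X Z A" and b: "b \<in> hom X Z B"
    and c: "c \<in> hom X Z C" and e: "e \<in> hom X Z E"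
  shows "\<langle>\<langle>a, b\<rangle>, \<langle>c, e\<rangle>\<rangle> \<cdot> interchange_map X A B C E = \<langle>\<langle>a, c\<rangle>, \<langle>b, e\<rangle>\<rangle>"
proof -
  note ob1 = homD(5)[OF a] homD(5)[OF b] and ob2 = homD(5)[OF c] homD(5)[OF e]
  note ab = pair_hom[OF a b] and ce = pair_hom[OF c e]
  note p0 = proj0_hom[OF ob1] proj0_hom[OF ob2] and p1 = proj1_hom[OF ob1] proj1_hom[OF ob2]
  show ?thesis
    unfolding interchange_map_def
    by (simp add: comp_pair[OF pair_hom[OF ab ce] prod_map_hom[OF p0] prod_map_hom[OF p1]]
        pair_prod_map[OF ab ce p0] pair_prod_map[OF ab ce p1]
        pair_proj0[OF a b] pair_proj0[OF c e] pair_proj1[OF a b] pair_proj1[OF c e])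
qed

end

section \<open>Derivatives at generalised elements\<close>

context cartesian_differential_category
begin

text \<open>
  The axioms CD.2, CD.6 and CD.7 compare maps out of products. Precomposing them with pairings
  gives equations between the values of derivatives at arbitrary elements of shape \<open>Z\<close>, which
  is the form in which they are used to calculate.
\<close>

lemma D_plus_direction:
  assumes f: "f \<in> hom X A B"
    and x: "x \<in> hom X Z A" and y: "y \<in> hom X Z A" and z: "z \<in> hom X Z A"
  shows "\<langle>x, y \<oplus> z\<rangle> \<cdot> D f = \<langle>x, y\<rangle> \<cdot> D f \<oplus> \<langle>x, z\<rangle> \<cdot> D f"
proof -
  note A = homD(4)[OF f]
  note i = id_hom[OF A] and p0 = proj0_hom[OF A A] and p1 = proj1_hom[OF A A]
  note yz = pair_hom[OF y z] and Df = D_hom[OF f]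
  note xyz = pair_hom[OF x yz]
  have s: "sum_map X A \<in> hom X (A \<^bold>\<times> A) A"
    unfolding sum_map_def by (rule plus_hom[OF p0 p1])
  note i_s = prod_map_hom[OF i s] and i0 = prod_map_hom[OF i p0] and i1 = prod_map_hom[OF i p1]
  have "\<langle>x, y \<oplus> z\<rangle> \<cdot> D f = \<langle>x, \<langle>y, z\<rangle>\<rangle> \<cdot> ((\<one> A \<otimes> sum_map X A) \<cdot> D f)"
    by (simp add: comp_assoc[OF xyz i_s Df, symmetric] pair_prod_map[OF x yz i s]
        comp_id[OF x] pair_sum_map[OF y z])
  also have "\<dots> = \<langle>x, \<langle>y, z\<rangle>\<rangle> \<cdot> ((\<one> A \<otimes> \<pi>\<^sub>0 A A) \<cdot> D f) \<oplus> \<langle>x, \<langle>y, z\<rangle>\<rangle> \<cdot> ((\<one> A \<otimes> \<pi>\<^sub>1 A A) \<cdot> D f)"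
    by (simp add: CD2_plus[OF f] comp_plus[OF xyz comp_hom[OF i0 Df] comp_hom[OF i1 Df]])
  also have "\<dots> = \<langle>x, y\<rangle> \<cdot> D f \<oplus> \<langle>x, z\<rangle> \<cdot> D f"
    by (simp add: comp_assoc[OF xyz i0 Df, symmetric] comp_assoc[OF xyz i1 Df, symmetric]
        pair_prod_map[OF x yz i p0] pair_prod_map[OF x yz i p1] comp_id[OF x]
        pair_proj0[OF y z] pair_proj1[OF y z])
  finally show ?thesis .
qed

lemma D_zero_direction:
  assumes f: "f \<in> hom X A B" and x: "x \<in> hom X Z A"
  shows "\<langle>x, \<zero> Z A\<rangle> \<cdot> D f = \<zero> Z B"
proof -
  note A = homD(4)[OF f]
  note i = id_hom[OF A] and z = zero_hom[OF A A]
  have "\<langle>x, \<zero> Z A\<rangle> \<cdot> D f = x \<cdot> (\<langle>\<one> A, \<zero> A A\<rangle> \<cdot> D f)"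
    by (simp add: comp_assoc[OF x pair_hom[OF i z] D_hom[OF f], symmetric]
        comp_pair[OF x i z] comp_id[OF x] comp_zero[OF x A])
  then show ?thesis
    by (simp add: CD2_zero[OF f] comp_zero[OF x homD(5)[OF f]])
qed

lemma D_D_lift:
  assumes f: "f \<in> hom X A B" and x: "x \<in> hom X Z A" and y: "y \<in> hom X Z A"
  shows "\<langle>\<langle>x, \<zero> Z A\<rangle>, \<langle>\<zero> Z A, y\<rangle>\<rangle> \<cdot> D (D f) = \<langle>x, y\<rangle> \<cdot> D f"
proof -
  note A = homD(4)[OF f]
  have "lift_map X A A A A \<in> hom X (A \<^bold>\<times> A) ((A \<^bold>\<times> A) \<^bold>\<times> (A \<^bold>\<times> A))"
    unfolding lift_map_def using A by (intro prod_map_hom pair_hom id_hom zero_hom)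
  from comp_assoc[OF pair_hom[OF x y] this D_hom[OF D_hom[OF f]]] show ?thesis
    by (simp add: CD6[OF f] pair_lift_map[OF x y A A])
qed

lemma D_D_interchange:
  assumes f: "f \<in> hom X A B" and x: "x \<in> hom X Z A" and y: "y \<in> hom X Z A"
    and u: "u \<in> hom X Z A" and v: "v \<in> hom X Z A"
  shows "\<langle>\<langle>x, y\<rangle>, \<langle>u, v\<rangle>\<rangle> \<cdot> D (D f) = \<langle>\<langle>x, u\<rangle>, \<langle>y, v\<rangle>\<rangle> \<cdot> D (D f)"
proof -
  note A = homD(4)[OF f]
  have "interchange_map X A A A A
      \<in> hom X ((A \<^bold>\<times> A) \<^bold>\<times> (A \<^bold>\<times> A)) ((A \<^bold>\<times> A) \<^bold>\<times> (A \<^bold>\<times> A))"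
    unfolding interchange_map_def using A by (intro prod_map_hom pair_hom proj0_hom proj1_hom)
  from comp_assoc[OF pair_hom[OF pair_hom[OF x y] pair_hom[OF u v]] this D_hom[OF D_hom[OF f]]]
  show ?thesis
    by (simp add: CD7[OF f] pair_interchange_map[OF x y u v])
qed

text \<open>
  By symmetry \<open>x\<close> and \<open>y\<close> can be moved together into the direction of the outer derivative,
  where additivity separates them. The part with \<open>x\<close> is, again by symmetry, a derivative in
  the direction \<open>0\<close>, so the value does not depend on \<open>x\<close>. The linearity of the linearization
  is the case where \<open>x\<close> and \<open>y\<close> are the two projections.
\<close>

lemma D_D_zero_base:
  assumes f: "f \<in> hom X A B" and x: "x \<in> hom X Z A" and y: "y \<in> hom X Z A"
  shows "\<langle>\<langle>\<zero> Z A, x\<rangle>, \<langle>\<zero> Z A, y\<rangle>\<rangle> \<cdot> D (D f) = \<langle>\<zero> Z A, y\<rangle> \<cdot> D f"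
proof -
  note ob = homD(4)[OF x] homD(4)[OF f]
  note Df = D_hom[OF f] and z = zero_hom[OF ob]
  note zz = pair_hom[OF z z] and xz = pair_hom[OF x z] and zy = pair_hom[OF z y]
  have split: "\<langle>x, y\<rangle> = \<langle>x, \<zero> Z A\<rangle> \<oplus> \<langle>\<zero> Z A, y\<rangle>"
    by (simp add: pair_plus[OF x z z y] plus_zero[OF x] zero_plus[OF y])
  have vanish: "\<langle>\<langle>\<zero> Z A, \<zero> Z A\<rangle>, \<langle>x, \<zero> Z A\<rangle>\<rangle> \<cdot> D (D f) = \<zero> Z B"
    using D_zero_direction[OF Df pair_hom[OF z x]]
    by (simp only: D_D_interchange[OF f z z x z] pair_zero[OF ob(1) ob(2) ob(2), symmetric])
  have "\<langle>\<langle>\<zero> Z A, x\<rangle>, \<langle>\<zero> Z A, y\<rangle>\<rangle> \<cdot> D (D f) = \<langle>\<langle>\<zero> Z A, \<zero> Z A\<rangle>, \<langle>x, y\<rangle>\<rangle> \<cdot> D (D f)"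
    by (rule D_D_interchange[OF f z x z y])
  also have "\<dots> = \<zero> Z B \<oplus> \<langle>\<langle>\<zero> Z A, \<zero> Z A\<rangle>, \<langle>\<zero> Z A, y\<rangle>\<rangle> \<cdot> D (D f)"
    by (simp add: split D_plus_direction[OF Df zz xz zy] vanish)
  also have "\<dots> = \<langle>\<zero> Z A, y\<rangle> \<cdot> D f"
    by (simp add: D_D_lift[OF f z y] zero_plus[OF comp_hom[OF zy Df]])
  finally show ?thesis .
qed

section \<open>The linearization and \<open>D\<close>-linear maps\<close>

lemma linearization_eq:
  assumes "f \<in> hom X A B"
  shows "linearization X D f = \<langle>\<zero> A A, \<one> A\<rangle> \<cdot> D f"
  by (simp add: linearization_def homD(2)[OF assms])

lemma zero_id_hom: "A \<in> Obj X \<Longrightarrow> \<langle>\<zero> A A, \<one> A\<rangle> \<in> hom X A (A \<^bold>\<times> A)"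
  by (intro pair_hom zero_hom id_hom)

lemma linearization_hom:
  assumes f: "f \<in> hom X A B"
  shows "linearization X D f \<in> hom X A B"
  unfolding linearization_eq[OF f] by (rule comp_hom[OF zero_id_hom[OF homD(4)[OF f]] D_hom[OF f]])

lemma comp_zero_id:
  assumes x: "x \<in> hom X Z A"
  shows "x \<cdot> \<langle>\<zero> A A, \<one> A\<rangle> = \<langle>\<zero> Z A, x\<rangle>"
  using homD(5)[OF x]
  by (simp add: comp_pair[OF x zero_hom id_hom] comp_zero[OF x] comp_id[OF x])

lemma D_linearization:
  assumes f: "f \<in> hom X A B"
  shows "D (linearization X D f) = \<pi>\<^sub>1 A A \<cdot> linearization X D f"
proof -
  note A = homD(4)[OF f]
  note p0 = proj0_hom[OF A A] and p1 = proj1_hom[OF A A] and k = zero_id_hom[OF A]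
  have "D (\<langle>\<zero> A A, \<one> A\<rangle>) = \<langle>\<zero> (A \<^bold>\<times> A) A, \<pi>\<^sub>1 A A\<rangle>"
    by (simp add: CD4[OF zero_hom[OF A A] id_hom[OF A]] CD1_zero[OF A A] CD3_id[OF A])
  then have "D (linearization X D f)
      = \<langle>\<langle>\<zero> (A \<^bold>\<times> A) A, \<pi>\<^sub>0 A A\<rangle>, \<langle>\<zero> (A \<^bold>\<times> A) A, \<pi>\<^sub>1 A A\<rangle>\<rangle> \<cdot> D (D f)"
    by (simp add: linearization_eq[OF f] CD5[OF k D_hom[OF f]] comp_zero_id[OF p0])
  also have "\<dots> = \<langle>\<zero> (A \<^bold>\<times> A) A, \<pi>\<^sub>1 A A\<rangle> \<cdot> D f"
    by (rule D_D_zero_base[OF f p0 p1])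
  also have "\<dots> = \<pi>\<^sub>1 A A \<cdot> linearization X D f"
    by (simp add: linearization_eq[OF f] comp_assoc[OF p1 k D_hom[OF f], symmetric]
        comp_zero_id[OF p1])
  finally show ?thesis .
qed

lemma D_linear_linearization:
  assumes "f \<in> hom X A B"
  shows "D_linear X D (linearization X D f)"
  using D_linearization[OF assms] homD(2)[OF linearization_hom[OF assms]]
  by (simp add: D_linear_def)

text \<open>
  This turns values of a \<open>D\<close>-linear map into values of its derivative, so that the behaviour
  of derivatives in the direction carries over to the map itself.
\<close>

lemma D_linear_apply:
  assumes f: "f \<in> hom X A B" and lin: "D_linear X D f" and x: "x \<in> hom X Z A"
  shows "\<langle>\<zero> Z A, x\<rangle> \<cdot> D f = x \<cdot> f"
proof -
  note A = homD(4)[OF f]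
  note z = zero_hom[OF homD(4)[OF x] A]
  have "D f = \<pi>\<^sub>1 A A \<cdot> f"
    using lin by (simp add: D_linear_def homD(2)[OF f])
  then show ?thesis
    by (simp add: comp_assoc[OF pair_hom[OF z x] proj1_hom[OF A A] f, symmetric]
        pair_proj1[OF z x])
qed

lemma D_linear_imp_additive:
  assumes f: "f \<in> hom X A B" and lin: "D_linear X D f"
  shows "additive X f"
proof -
  note A = homD(4)[OF f]
  have "\<zero> C A \<cdot> f = \<zero> C B" if C: "C \<in> Obj X" for C
    using D_zero_direction[OF f zero_hom[OF C A]] D_linear_apply[OF f lin zero_hom[OF C A]] by simp
  moreover have "(g \<oplus> h) \<cdot> f = g \<cdot> f \<oplus> h \<cdot> f"
    if C: "C \<in> Obj X" and g: "g \<in> hom X C A" and h: "h \<in> hom X C A" for C g h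
    using D_plus_direction[OF f zero_hom[OF C A] g h]
    by (simp add: D_linear_apply[OF f lin] g h plus_hom[OF g h])
  ultimately show ?thesis
    by (simp add: additive_def reduced_def semi_additive_def homD(2,3)[OF f])
qed

lemma D_linear_iff_L_linear:
  assumes f: "f \<in> hom X A B"
  shows "D_linear X D f \<longleftrightarrow> L_linear (linearization X D) f"
proof
  assume "D_linear X D f"
  from D_linear_apply[OF f this id_hom[OF homD(4)[OF f]]]
  show "L_linear (linearization X D) f"
    by (simp add: L_linear_def linearization_eq[OF f] id_comp[OF f])
next
  assume "L_linear (linearization X D) f"
  with D_linear_linearization[OF f] show "D_linear X D f"
    by (simp add: L_linear_def)
qed

section \<open>The chain rule at zero\<close>

lemma linearization_comp_eq_D:
  assumes f: "f \<in> hom X A B" and g: "g \<in> hom X B C"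
  shows "linearization X D (f \<cdot> g) = \<langle>\<zero> A A \<cdot> f, linearization X D f\<rangle> \<cdot> D g"
proof -
  note A = homD(4)[OF f]
  note k = zero_id_hom[OF A] and p0 = proj0_hom[OF A A] and Df = D_hom[OF f]
  have "linearization X D (f \<cdot> g)
      = (\<langle>\<zero> A A, \<one> A\<rangle> \<cdot> \<langle>\<pi>\<^sub>0 A A \<cdot> f, D f\<rangle>) \<cdot> D g"
    by (simp add: linearization_eq[OF comp_hom[OF f g]] CD5[OF f g]
        comp_assoc[OF k pair_hom[OF comp_hom[OF p0 f] Df] D_hom[OF g]])
  also have "\<langle>\<zero> A A, \<one> A\<rangle> \<cdot> \<langle>\<pi>\<^sub>0 A A \<cdot> f, D f\<rangle> = \<langle>\<zero> A A \<cdot> f, linearization X D f\<rangle>"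
    by (simp add: comp_pair[OF k comp_hom[OF p0 f] Df] comp_assoc[OF k p0 f, symmetric]
        pair_proj0[OF zero_hom[OF A A] id_hom[OF A]] linearization_eq[OF f])
  finally show ?thesis .
qed

text \<open>
  The map \<open>0 f\<close> is a constant point of \<open>B\<close>, and its derivative vanishes; hence the translation
  \<open>1 + 0 f\<close> has the identity as its linearization, whereas it sends \<open>0\<close> to \<open>0 f\<close>.
\<close>

lemma linearization_translation:
  assumes f: "f \<in> hom X A B"
  shows "linearization X D (\<one> B \<oplus> \<zero> B A \<cdot> f) = \<one> B"
proof -
  note A = homD(4)[OF f] and B = homD(5)[OF f]
  note z = zero_hom[OF B A] and i = id_hom[OF B] and k = zero_id_hom[OF B] and p1 = proj1_hom[OF B B]
  have "D (\<zero> B A \<cdot> f) = \<zero> (B \<^bold>\<times> B) B"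
    using D_zero_direction[OF f comp_hom[OF proj0_hom[OF B B] z]]
    by (simp add: CD5[OF z f] CD1_zero[OF B A])
  then have "D (\<one> B \<oplus> \<zero> B A \<cdot> f) = \<pi>\<^sub>1 B B"
    by (simp add: CD1_plus[OF i comp_hom[OF z f]] CD3_id[OF B] plus_zero[OF p1])
  then show ?thesis
    by (simp add: linearization_eq[OF plus_hom[OF i comp_hom[OF z f]]]
        pair_proj1[OF zero_hom[OF B B] i])
qed

lemma linearization_comp:
  assumes f: "f \<in> hom X A B" and g: "g \<in> hom X B C"
  shows "linearization X D (f \<cdot> g)
    = linearization X D f \<cdot> linearization X D ((\<one> B \<oplus> \<zero> B A \<cdot> f) \<cdot> g)"
proof -
  let ?t = "\<one> B \<oplus> \<zero> B A \<cdot> f"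
  note A = homD(4)[OF f] and B = homD(5)[OF f] and L = linearization_hom[OF f]
  note z = zero_hom[OF B A] and zB = zero_hom[OF B B] and i = id_hom[OF B]
  note zf = comp_hom[OF z f]
  have t: "?t \<in> hom X B B" by (rule plus_hom[OF i zf])
  have base: "\<zero> B B \<cdot> ?t = \<zero> B A \<cdot> f"
    by (simp add: comp_plus[OF zB i zf] comp_id[OF zB] comp_assoc[OF zB z f, symmetric]
        comp_zero[OF zB A] zero_plus[OF zf])
  have "linearization X D f \<cdot> linearization X D (?t \<cdot> g)
      = linearization X D f \<cdot> (\<langle>\<zero> B A \<cdot> f, \<one> B\<rangle> \<cdot> D g)"
    by (simp add: linearization_comp_eq_D[OF t g] base linearization_translation[OF f])
  also have "\<dots> = \<langle>\<zero> A A \<cdot> f, linearization X D f\<rangle> \<cdot> D g"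
    by (simp add: comp_assoc[OF L pair_hom[OF zf i] D_hom[OF g], symmetric]
        comp_pair[OF L zf i] comp_id[OF L] comp_assoc[OF L z f, symmetric] comp_zero[OF L A])
  finally show ?thesis
    by (simp add: linearization_comp_eq_D[OF f g])
qed

section \<open>The linearizing combinator\<close>

lemma linearization_proj:
  assumes A: "A \<in> Obj X" and B: "B \<in> Obj X"
  shows "linearization X D (\<pi>\<^sub>0 A B) = \<pi>\<^sub>0 A B" "linearization X D (\<pi>\<^sub>1 A B) = \<pi>\<^sub>1 A B"
proof -
  note p0 = proj0_hom[OF A B] and p1 = proj1_hom[OF A B]
  have "D_linear X D (\<pi>\<^sub>0 A B)" "D_linear X D (\<pi>\<^sub>1 A B)"
    by (simp_all add: D_linear_def homD(2)[OF p0] homD(2)[OF p1] CD3_proj0[OF A B] CD3_proj1[OF A B])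
  then show "linearization X D (\<pi>\<^sub>0 A B) = \<pi>\<^sub>0 A B" "linearization X D (\<pi>\<^sub>1 A B) = \<pi>\<^sub>1 A B"
    using D_linear_iff_L_linear[OF p0] D_linear_iff_L_linear[OF p1] by (simp_all add: L_linear_def)
qed

lemma linearizing_combinator_linearization: "linearizing_combinator X (linearization X D)"
proof unfold_locales
  fix f g A B
  assume f: "f \<in> hom X A B" and g: "g \<in> hom X A B"
  show "linearization X D (f \<oplus> g) = linearization X D f \<oplus> linearization X D g"
    by (simp add: linearization_eq[OF plus_hom[OF f g]] linearization_eq[OF f]
        linearization_eq[OF g] CD1_plus[OF f g]
        comp_plus[OF zero_id_hom[OF homD(4)[OF f]] D_hom[OF f] D_hom[OF g]])
next
  fix A B
  assume A: "A \<in> Obj X" and B: "B \<in> Obj X"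
  show "linearization X D (\<zero> A B) = \<zero> A B"
    by (simp add: linearization_eq[OF zero_hom[OF A B]] CD1_zero[OF A B]
        comp_zero[OF zero_id_hom[OF A] B])
next
  fix f A B
  assume f: "f \<in> hom X A B"
  show "additive X (linearization X D f)"
    by (rule D_linear_imp_additive[OF linearization_hom[OF f] D_linear_linearization[OF f]])
next
  fix A
  assume A: "A \<in> Obj X"
  show "linearization X D (\<one> A) = \<one> A"
    by (simp add: linearization_eq[OF id_hom[OF A]] CD3_id[OF A]
        pair_proj1[OF zero_hom[OF A A] id_hom[OF A]])
next
  fix f g C A B
  assume f: "f \<in> hom X C A" and g: "g \<in> hom X C B"
  show "linearization X D (\<langle>f, g\<rangle>) = \<langle>linearization X D f, linearization X D g\<rangle>"
    by (simp add: linearization_eq[OF pair_hom[OF f g]] linearization_eq[OF f]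
        linearization_eq[OF g] CD4[OF f g]
        comp_pair[OF zero_id_hom[OF homD(4)[OF f]] D_hom[OF f] D_hom[OF g]])
next
  fix f A B
  assume f: "f \<in> hom X A B"
  show "linearization X D (linearization X D f) = linearization X D f"
    using D_linear_iff_L_linear[OF linearization_hom[OF f]] D_linear_linearization[OF f]
    by (simp add: L_linear_def)
qed (fact linearization_hom linearization_proj linearization_comp)+

end

theorem proposition3p6:
  fixes X :: "('o, 'm, 'x) cartesian_left_additive_cat_scheme"
    and D :: "'m \<Rightarrow> 'm"
  assumes "cartesian_differential_category X D"
  shows "linearizing_combinator X (linearization X D) \<and>
    (\<forall>f \<in> Arr X. D_linear X D (linearization X D f)) \<and>
    (\<forall>f \<in> Arr X. D_linear X D f \<longleftrightarrow> L_linear (linearization X D) f)"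
proof -
  interpret cartesian_differential_category X D by (fact assms)
  have "f \<in> hom X (Dom X f) (Cod X f)" if "f \<in> Arr X" for f
    using that by (simp add: hom_def)
  then show ?thesis
    using linearizing_combinator_linearization D_linear_linearization D_linear_iff_L_linear
    by blast
qed

end
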